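(* Let $\mathcal X,\mathcal Y$ be finite sets and let $\pi_1,\pi_2$ be arbitrary probability distributions on $\mathcal X\times\mathcal Y$. Then $$\Gamma(\pi_1\otimes\pi_2)=\Gamma(\pi_1)+\Gamma(\pi_2).$$ Consequently, for every probability distribution $\pi$ on $\mathcal X\times\mathcal Y$ and every positive integer $n$, $$\Gamma(\pi^{\otimes n})=n\,\Gamma(\pi).$$
   Context: All alphabets are finite and all logarithms are natural; conventions $0\log 0=0$ and $0\cdot\infty=0$. $H$ denotes Shannon entropy. For probability distributions $P$ on a finite set $\mathcal A$ and $Q$ on a finite set $\mathcal B$, let $\mathcal C(P,Q)$ be the set of couplings of $P$ and $Q$ (joint distributions on $\mathcal A\times\mathcal B$ with marginals $P$ and $Q$). For a cost $c:\mathcal A\times\mathcal B\to[0,\infty]$ define $$\mathcal T_c(P,Q):=\sup_{R\in\mathcal C(P,Q)}\mathbb E_R[c(X,Y)],\qquad \Phi_c(P,Q):=\mathcal T_c(P,Q)-H(P)-H(Q).$$ For a probability distribution $\pi$ on $\mathcal A\times\mathcal B$, put $c_\pi(x,y):=\log\frac1{\pi(x,y)}$, with $c_\pi(x,y)=+\infty$ when $\pi(x,y)=0$, and define $$\Gamma(\pi):=\inf\ \mathbb E_W\big[\Phi_{c_\pi}(P_{X|W},P_{Y|W})\big]=\inf\ \sum_w P_W(w)\,\Phi_{c_\pi}(P_{X|W=w},P_{Y|W=w}),$$ where the infimum is over all joint distributions of the form $P_{WXY}=P_WP_{X|W}P_{Y|W}$ (i.e. $X$ and $Y$ conditionally independent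 given $W$), with $W$ taking values in an arbitrary finite alphabet, $X\in\mathcal A$, $Y\in\mathcal B$, and $P_{XY}=\pi$. The product $\pi_1\otimes\pi_2$ is regarded as a bivariate source on $\mathcal X^2\times\mathcal Y^2$, i.e. as the distribution of $((X_1,X_2),(Y_1,Y_2))$ with probability $\pi_1(x_1,y_1)\pi_2(x_2,y_2)$; likewise $\pi^{\otimes n}$ is regarded as the distribution of $(X^n,Y^n)$ on $\mathcal X^n\times\mathcal Y^n$ with probability $\prod_{i=1}^n\pi(x_i,y_i)$. *)

theory Defs
  imports "HOL-Probability.Probability"
begin

text \<open>Distributions on a finite set \<open>A\<close> are represented by probability mass functions whose support
  is contained in \<open>A\<close>; the marginals of a coupling then have their supports in the right sets
  automatically, so no alphabet parameter is needed below.\<close>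

definition shannon_entropy :: "'a pmf \<Rightarrow> real" where
  "shannon_entropy P = - (\<Sum>x\<in>set_pmf P. pmf P x * ln (pmf P x))"

definition couplings :: "'a pmf \<Rightarrow> 'b pmf \<Rightarrow> ('a \<times> 'b) pmf set" where
  "couplings P Q = {R. map_pmf fst R = P \<and> map_pmf snd R = Q}"

definition max_transport :: "('a \<Rightarrow> 'b \<Rightarrow> ennreal) \<Rightarrow> 'a pmf \<Rightarrow> 'b pmf \<Rightarrow> ennreal" where
  "max_transport c P Q = (SUP R\<in>couplings P Q. \<integral>\<^sup>+(x, y). c x y \<partial>measure_pmf R)"

definition Phi :: "('a \<Rightarrow> 'b \<Rightarrow> ennreal) \<Rightarrow> 'a pmf \<Rightarrow> 'b pmf \<Rightarrow> ereal" where
  "Phi c P Q = enn2ereal (max_transport c P Q) - ereal (shannon_entropy P) - ereal (shannon_entropy Q)"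

definition log_cost :: "('a \<times> 'b) pmf \<Rightarrow> 'a \<Rightarrow> 'b \<Rightarrow> ennreal" where
  "log_cost \<pi> x y = (if pmf \<pi> (x, y) = 0 then \<infinity> else ennreal (ln (1 / pmf \<pi> (x, y))))"

text \<open>A triple \<open>(PW, PX, PY)\<close> stands for the joint law \<open>P\<^sub>W P\<^sub>X\<^sub>|\<^sub>W P\<^sub>Y\<^sub>|\<^sub>W\<close>.  The finite alphabet of \<open>W\<close>
  is, up to relabelling, a finite set of natural numbers; values of the kernels \<open>PX\<close>, \<open>PY\<close> outside the
  support of \<open>PW\<close> play no role.\<close>

definition cond_indep_decomps ::
    "('a \<times> 'b) pmf \<Rightarrow> (nat pmf \<times> (nat \<Rightarrow> 'a pmf) \<times> (nat \<Rightarrow> 'b pmf)) set" where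
  "cond_indep_decomps \<pi> =
     {(PW, PX, PY). finite (set_pmf PW) \<and> bind_pmf PW (\<lambda>w. pair_pmf (PX w) (PY w)) = \<pi>}"

definition Gamma_src :: "('a \<times> 'b) pmf \<Rightarrow> ereal" where
  "Gamma_src \<pi> = (INF (PW, PX, PY)\<in>cond_indep_decomps \<pi>.
     \<Sum>w\<in>set_pmf PW. ereal (pmf PW w) * Phi (log_cost \<pi>) (PX w) (PY w))"

definition source_prod ::
    "('a \<times> 'b) pmf \<Rightarrow> ('a \<times> 'b) pmf \<Rightarrow> (('a \<times> 'a) \<times> ('b \<times> 'b)) pmf" where
  "source_prod \<pi>\<^sub>1 \<pi>\<^sub>2 =
     map_pmf (\<lambda>((x1, y1), (x2, y2)). ((x1, x2), (y1, y2))) (pair_pmf \<pi>\<^sub>1 \<pi>\<^sub>2)"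

text \<open>Elements of the \<open>n\<close>-fold power of an alphabet are represented by lists of length \<open>n\<close>.\<close>

definition source_power :: "nat \<Rightarrow> ('a \<times> 'b) pmf \<Rightarrow> ('a list \<times> 'b list) pmf" where
  "source_power n \<pi> = map_pmf (\<lambda>zs. (map fst zs, map snd zs)) (replicate_pmf n \<pi>)"

lemma pmf_source_prod:
  "pmf (source_prod \<pi>\<^sub>1 \<pi>\<^sub>2) ((x1, x2), (y1, y2)) = pmf \<pi>\<^sub>1 (x1, y1) * pmf \<pi>\<^sub>2 (x2, y2)"
proof -
  let ?f = "\<lambda>((x1, y1), (x2, y2)). ((x1, x2), (y1, y2))"
  have "inj ?f" by (auto simp: inj_def)
  from pmf_map_inj'[OF this, of "pair_pmf \<pi>\<^sub>1 \<pi>\<^sub>2" "((x1, y1), (x2, y2))"]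
  show ?thesis by (simp add: source_prod_def pmf_pair)
qed

lemma pmf_replicate_pmf_prod_list:
  "length zs = n \<Longrightarrow> pmf (replicate_pmf n \<pi>) zs = (\<Prod>i<n. pmf \<pi> (zs ! i))"
proof (induction n arbitrary: zs)
  case 0
  then show ?case by simp
next
  case (Suc n)
  then obtain a as where zs: "zs = a # as" "length as = n" by (cases zs) auto
  have inj: "inj (\<lambda>(x, xs). x # xs)" by (auto simp: inj_def)
  have "replicate_pmf (Suc n) \<pi> = map_pmf (\<lambda>(x, xs). x # xs) (pair_pmf \<pi> (replicate_pmf n \<pi>))"
    by (simp add: pair_pmf_def map_bind_pmf)
  then have "pmf (replicate_pmf (Suc n) \<pi>) zs = pmf \<pi> a * pmf (replicate_pmf n \<pi>) as"
    using pmf_map_inj'[OF inj, of "pair_pmf \<pi> (replicate_pmf n \<pi>)" "(a, as)"] zs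
    by (simp add: pmf_pair)
  then show ?case using Suc.IH[OF zs(2)] zs(1)
    by (simp add: prod.lessThan_Suc_shift del: prod.lessThan_Suc)
qed

lemma pmf_source_power:
  assumes "length xs = n" "length ys = n"
  shows "pmf (source_power n \<pi>) (xs, ys) = (\<Prod>i<n. pmf \<pi> (xs ! i, ys ! i))"
proof -
  have inj: "inj (\<lambda>zs :: ('a \<times> 'b) list. (map fst zs, map snd zs))"
    by (rule injI) (metis prod.inject zip_map_fst_snd)
  show ?thesis
    using pmf_map_inj'[OF inj, of "replicate_pmf n \<pi>" "zip xs ys"] assms
    by (simp add: source_power_def pmf_replicate_pmf_prod_list)
qed

end

theory Submission
  imports Defs
begin

text \<open>Superadditivity is the nontrivial direction.  Given \<open>W\<close> with \<open>X\<^sub>1X\<^sub>2\<close> and \<open>Y\<^sub>1Y\<^sub>2\<close> conditionally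
  independent, use \<open>W\<^sub>1 = (W, Y\<^sub>2)\<close> for \<open>\<pi>\<^sub>1\<close> and \<open>W\<^sub>2 = (W, X\<^sub>1)\<close> for \<open>\<pi>\<^sub>2\<close>.  Expanding the entropies in
  opposite orders, \<open>H(X\<^sub>1) + H(X\<^sub>2|X\<^sub>1)\<close> and \<open>H(Y\<^sub>2) + H(Y\<^sub>1|Y\<^sub>2)\<close>, they match the entropies in the two
  objectives exactly.  For the transport terms, couple \<open>P\<close> and \<open>Q\<close> by drawing \<open>X\<^sub>1\<close> and \<open>Y\<^sub>2\<close>
  independently: given \<open>Y\<^sub>2 = y\<close>, a coupling of \<open>P\<^bsub>X\<^sub>1\<^esub>\<close> with \<open>Q\<^bsub>Y\<^sub>1|Y\<^sub>2=y\<^esub>\<close> leaves \<open>X\<^sub>1\<close> with its own law, and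
  likewise for \<open>(X\<^sub>2, Y\<^sub>2)\<close> given \<open>X\<^sub>1\<close>, so near-optimal couplings of both kinds glue together.
  Subadditivity follows from product decompositions, and the statement on powers from additivity and
  invariance under injective relabelling of the alphabets.\<close>

text \<open>Unlike \<open>source_prod\<close>, the two factors may have different alphabets, as the induction on
  powers requires.\<close>

definition prod_source :: "('a \<times> 'b) pmf \<Rightarrow> ('c \<times> 'd) pmf \<Rightarrow> (('a \<times> 'c) \<times> ('b \<times> 'd)) pmf" where
  "prod_source \<pi>\<^sub>1 \<pi>\<^sub>2 = map_pmf (\<lambda>((x1, y1), (x2, y2)). ((x1, x2), (y1, y2))) (pair_pmf \<pi>\<^sub>1 \<pi>\<^sub>2)"

section \<open>Real-valued objective and conditional laws\<close>

text \<open>Finite stand-in for \<open>log_cost\<close>: outside the support the value is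
  \<open>- ln 0 = 0\<close> instead of infinity, so the two agree only on the support of
  \<open>P\<close>.\<close>

definition log_loss :: "'a pmf \<Rightarrow> 'a \<Rightarrow> real" where
  "log_loss P z = - ln (pmf P z)"

text \<open>The supremum is taken in the reals, hence meaningful only when the expectations are
  bounded; this holds when \<open>set_pmf P \<times> set_pmf Q\<close> lies in a finite
  \<open>set_pmf \<pi>\<close>.\<close>

definition transport :: "('a \<times> 'b) pmf \<Rightarrow> 'a pmf \<Rightarrow> 'b pmf \<Rightarrow> real" where
  "transport \<pi> P Q = (SUP R\<in>couplings P Q. measure_pmf.expectation R (log_loss \<pi>))"

definition phi :: "('a \<times> 'b) pmf \<Rightarrow> 'a pmf \<Rightarrow> 'b pmf \<Rightarrow> real" where
  "phi \<pi> P Q = transport \<pi> P Q - shannon_entropy P - shannon_entropy Q"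

text \<open>A genuine conditional law only if \<open>a\<close> has positive probability as first
  coordinate; elsewhere \<open>cond_pmf\<close> is unspecified.\<close>

definition cond_snd :: "('a \<times> 'b) pmf \<Rightarrow> 'a \<Rightarrow> 'b pmf" where
  "cond_snd P a = map_pmf snd (cond_pmf P {z. fst z = a})"

definition cond_fst :: "('a \<times> 'b) pmf \<Rightarrow> 'b \<Rightarrow> 'a pmf" where
  "cond_fst P b = cond_snd (map_pmf prod.swap P) b"

lemma log_loss_nonneg: "log_loss P z \<ge> 0"
  by (cases "pmf P z = 0") (auto simp: log_loss_def pmf_le_1 ln_le_zero_iff less_le)

section \<open>Disintegration and the chain rule for entropy\<close>

lemma disintegrate: "bind_pmf (map_pmf fst P) (\<lambda>a. map_pmf (Pair a) (cond_snd P a)) = P"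
proof -
  \<comment> \<open>Given that the first coordinate is \<open>a\<close>, it is constant, so
    restoring it after the projection loses nothing.\<close>
  have "map_pmf (Pair a) (cond_snd P a) = cond_pmf P {z. fst z = a}" if "a \<in> set_pmf (map_pmf fst P)" for a
  proof -
    have "set_pmf P \<inter> {z. fst z = a} \<noteq> {}" using that by auto
    then have "map_pmf (\<lambda>z. (a, snd z)) (cond_pmf P {z. fst z = a}) = map_pmf id (cond_pmf P {z. fst z = a})"
      by (intro map_pmf_cong) auto
    then show ?thesis by (simp add: cond_snd_def map_pmf_comp)
  qed
  then have "bind_pmf (map_pmf fst P) (\<lambda>a. map_pmf (Pair a) (cond_snd P a))
      = bind_pmf (map_pmf fst P) (\<lambda>a. cond_pmf P {z. fst z = a})"
    by (intro bind_pmf_cong) auto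
  also have "\<dots> = P"
    by (rule bind_cond_pmf_cancel) (auto simp: vimage_def eq_commute)
  finally show ?thesis .
qed

lemma bind_cond_snd: "bind_pmf (map_pmf fst P) (cond_snd P) = map_pmf snd P"
  by (subst (3) disintegrate[symmetric]) (simp add: map_bind_pmf map_pmf_comp)

lemma bind_cond_fst: "bind_pmf (map_pmf snd P) (cond_fst P) = map_pmf fst P"
  using bind_cond_snd[of "map_pmf prod.swap P"]
  by (simp add: cond_fst_def[abs_def] map_pmf_comp)

lemma disintegrate': "bind_pmf (map_pmf snd P) (\<lambda>b. map_pmf (\<lambda>a. (a, b)) (cond_fst P b)) = P"
  using arg_cong[OF disintegrate[of "map_pmf prod.swap P"], of "map_pmf prod.swap"]
  by (simp add: cond_fst_def map_pmf_comp map_bind_pmf)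

text \<open>Entropy as an expected log loss, so that the tower property applies to it.\<close>

lemma shannon_entropy_eq: "finite (set_pmf P) \<Longrightarrow> shannon_entropy P = measure_pmf.expectation P (log_loss P)"
  by (subst integral_measure_pmf_real[of "set_pmf P"])
     (auto simp: shannon_entropy_def log_loss_def sum_negf mult.commute)

lemma pmf_bind_Pair: "pmf (bind_pmf P (\<lambda>a. map_pmf (Pair a) (K a))) (a, b) = pmf P a * pmf (K a) b"
proof -
  have *: "pmf (map_pmf (Pair a') (K a')) (a, b) = indicator {a} a' * pmf (K a) b" for a'
  proof (cases "a' = a")
    case True
    have "inj (Pair a)" by (auto simp: inj_def)
    from pmf_map_inj'[OF this, of "K a" b] True show ?thesis by simp
  next
    case False
    then have "(a, b) \<notin> set_pmf (map_pmf (Pair a') (K a'))" by auto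
    with False show ?thesis by (simp add: pmf_eq_0_set_pmf)
  qed
  show ?thesis
    unfolding pmf_bind * by (simp add: pmf.rep_eq)
qed

text \<open>The chain rule: on the support the joint mass is a product of positive factors, so its
  log loss is a sum, and averaging over the second coordinate turns the second summand into the
  entropy of \<open>K a\<close>.\<close>

lemma shannon_entropy_bind_Pair:
  assumes "finite (set_pmf P)" "\<And>a. a \<in> set_pmf P \<Longrightarrow> finite (set_pmf (K a))"
  shows "shannon_entropy (bind_pmf P (\<lambda>a. map_pmf (Pair a) (K a))) =
    shannon_entropy P + measure_pmf.expectation P (\<lambda>a. shannon_entropy (K a))"
proof -
  let ?J = "bind_pmf P (\<lambda>a. map_pmf (Pair a) (K a))"
  have fin: "finite (set_pmf ?J)" using assms by auto
  have "shannon_entropy ?J = (\<Sum>a\<in>set_pmf P. pmf P a * measure_pmf.expectation (K a) (\<lambda>b. log_loss ?J (a, b)))"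
    unfolding shannon_entropy_eq[OF fin]
    by (subst pmf_expectation_bind[OF assms(1)]) (auto simp: assms)
  also have "\<dots> = (\<Sum>a\<in>set_pmf P. pmf P a * (log_loss P a + shannon_entropy (K a)))"
  proof (intro sum.cong refl arg_cong2[where f = "(*)"])
    fix a assume a: "a \<in> set_pmf P"
    have "measure_pmf.expectation (K a) (\<lambda>b. log_loss ?J (a, b)) =
        measure_pmf.expectation (K a) (\<lambda>b. log_loss P a + log_loss (K a) b)"
    proof (intro integral_cong_AE AE_pmfI)
      fix b assume "b \<in> set_pmf (K a)"
      then have "pmf P a > 0" "pmf (K a) b > 0" using a by (auto intro: pmf_positive)
      then show "log_loss ?J (a, b) = log_loss P a + log_loss (K a) b"
        by (simp add: log_loss_def pmf_bind_Pair ln_mult)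
    qed auto
    also have "\<dots> = log_loss P a + shannon_entropy (K a)"
      using a assms by (subst Bochner_Integration.integral_add)
        (auto simp: integrable_measure_pmf_finite shannon_entropy_eq)
    finally show "measure_pmf.expectation (K a) (\<lambda>b. log_loss ?J (a, b)) = log_loss P a + shannon_entropy (K a)" .
  qed
  also have "\<dots> = shannon_entropy P + measure_pmf.expectation P (\<lambda>a. shannon_entropy (K a))"
    unfolding shannon_entropy_eq[OF assms(1)]
    by (subst (1 2) integral_measure_pmf_real[OF assms(1)]) (auto simp: distrib_left sum.distrib mult.commute)
  finally show ?thesis .
qed

lemma shannon_entropy_map_inj:
  assumes "inj_on f (set_pmf P)"
  shows "shannon_entropy (map_pmf f P) = shannon_entropy P"
  unfolding shannon_entropy_def
  by (simp add: sum.reindex[OF assms] pmf_map_inj[OF assms])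

lemma shannon_entropy_pair:
  assumes "finite (set_pmf P)" "finite (set_pmf Q)"
  shows "shannon_entropy (pair_pmf P Q) = shannon_entropy P + shannon_entropy Q"
  using shannon_entropy_bind_Pair[of P "\<lambda>_. Q"] assms
  by (simp add: pair_pmf_def map_pmf_def)

lemma finite_cond_snd: "finite (set_pmf P) \<Longrightarrow> a \<in> fst ` set_pmf P \<Longrightarrow> finite (set_pmf (cond_snd P a))"
  unfolding cond_snd_def by (subst set_map_pmf, subst set_cond_pmf) auto

lemma shannon_entropy_cond_snd:
  assumes "finite (set_pmf P)"
  shows "shannon_entropy P = shannon_entropy (map_pmf fst P)
    + measure_pmf.expectation (map_pmf fst P) (\<lambda>a. shannon_entropy (cond_snd P a))"
  by (subst disintegrate[of P, symmetric], subst shannon_entropy_bind_Pair)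
     (use assms in \<open>auto simp: finite_cond_snd\<close>)

lemma shannon_entropy_cond_fst:
  assumes "finite (set_pmf P)"
  shows "shannon_entropy P = shannon_entropy (map_pmf snd P)
    + measure_pmf.expectation (map_pmf snd P) (\<lambda>b. shannon_entropy (cond_fst P b))"
  using shannon_entropy_cond_snd[of "map_pmf prod.swap P"] assms
  by (simp add: shannon_entropy_map_inj map_pmf_comp cond_fst_def del: integral_map_pmf)

text \<open>From \<open>ln t \<le> t - 1\<close> at \<open>t = 1 / p\<close> each summand is at most
  \<open>1 - p\<close>. The crude bound is enough, since it only serves to keep the infimum away
  from minus infinity.\<close>

lemma shannon_entropy_le_card: "shannon_entropy P \<le> card (set_pmf P)"
proof -
  have "- (pmf P x * ln (pmf P x)) \<le> 1" if "x \<in> set_pmf P" for x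
  proof -
    have p: "pmf P x > 0" "pmf P x \<le> 1" using that by (auto simp: pmf_positive pmf_le_1)
    have "ln (1 / pmf P x) \<le> 1 / pmf P x - 1" using p by (intro ln_le_minus_one) auto
    then have "pmf P x * ln (1 / pmf P x) \<le> pmf P x * (1 / pmf P x - 1)"
      using p by (intro mult_left_mono) auto
    also have "\<dots> \<le> 1" using p by (simp add: field_simps)
    finally show ?thesis using p by (simp add: ln_div)
  qed
  then show ?thesis unfolding shannon_entropy_def sum_negf[symmetric]
    using sum_bounded_above[of "set_pmf P" "\<lambda>x. - (pmf P x * ln (pmf P x))" 1] by simp
qed


lemma set_cond_snd: "a \<in> fst ` set_pmf P \<Longrightarrow> set_pmf (cond_snd P a) = {b. (a, b) \<in> set_pmf P}"
  unfolding cond_snd_def by (subst set_map_pmf, subst set_cond_pmf) force+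

lemma set_cond_fst: "b \<in> snd ` set_pmf P \<Longrightarrow> set_pmf (cond_fst P b) = {a. (a, b) \<in> set_pmf P}"
  unfolding cond_fst_def by (subst set_cond_snd) force+

section \<open>Couplings and finiteness of the transport term\<close>

lemma couplings_support: "R \<in> couplings P Q \<Longrightarrow> set_pmf R \<subseteq> set_pmf P \<times> set_pmf Q"
  by (force simp: couplings_def)

lemma pair_pmf_in_couplings: "pair_pmf P Q \<in> couplings P Q"
  by (simp add: couplings_def map_fst_pair_pmf map_snd_pair_pmf)

text \<open>Both sides of the rectangle are nonempty, so each is a projection of a finite
  set.\<close>

lemma finite_supports:
  assumes "finite (set_pmf \<pi>)" "set_pmf P \<times> set_pmf Q \<subseteq> set_pmf \<pi>"
  shows "finite (set_pmf P)" "finite (set_pmf Q)"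
  using finite_subset[OF assms(2,1)] set_pmf_not_empty[of P] set_pmf_not_empty[of Q]
  by (blast dest: finite_cartesian_productD1 finite_cartesian_productD2)+

context
  fixes \<pi> :: "('a \<times> 'b) pmf" and P Q
  assumes fin: "finite (set_pmf \<pi>)" and sub: "set_pmf P \<times> set_pmf Q \<subseteq> set_pmf \<pi>"
begin

text \<open>The rectangle assumption puts every coupling inside the finite support of
  \<open>\<pi>\<close>; replacing all its masses by 1 there gives a bound independent of the
  coupling.\<close>

lemma bdd_above_expectation_log_loss:
  "bdd_above ((\<lambda>R. measure_pmf.expectation R (log_loss \<pi>)) ` couplings P Q)"
proof (rule bdd_aboveI2)
  fix R assume "R \<in> couplings P Q"
  then have "measure_pmf.expectation R (log_loss \<pi>) = (\<Sum>z\<in>set_pmf \<pi>. log_loss \<pi> z * pmf R z)"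
    using couplings_support[of R P Q] sub by (intro integral_measure_pmf_real fin) auto
  also have "\<dots> \<le> (\<Sum>z\<in>set_pmf \<pi>. log_loss \<pi> z)"
    by (intro sum_mono mult_left_le pmf_le_1 log_loss_nonneg)
  finally show "measure_pmf.expectation R (log_loss \<pi>) \<le> (\<Sum>z\<in>set_pmf \<pi>. log_loss \<pi> z)" .
qed

lemma expectation_le_transport:
  "R \<in> couplings P Q \<Longrightarrow> measure_pmf.expectation R (log_loss \<pi>) \<le> transport \<pi> P Q"
  unfolding transport_def by (rule cSUP_upper[OF _ bdd_above_expectation_log_loss])

lemma transport_le:
  "(\<And>R. R \<in> couplings P Q \<Longrightarrow> measure_pmf.expectation R (log_loss \<pi>) \<le> t) \<Longrightarrow> transport \<pi> P Q \<le> t"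
  unfolding transport_def by (rule cSUP_least) (use pair_pmf_in_couplings in auto)

lemma transport_nonneg: "transport \<pi> P Q \<ge> 0"
  by (rule order_trans[OF _ expectation_le_transport[OF pair_pmf_in_couplings]])
     (simp add: integral_nonneg log_loss_nonneg)

text \<open>The supremum is in fact attained, by compactness, but near-optimal couplings suffice and
  need only the definition of a supremum.\<close>

lemma ex_coupling_near_transport:
  assumes "e > 0"
  shows "\<exists>R\<in>couplings P Q. transport \<pi> P Q - e < measure_pmf.expectation R (log_loss \<pi>)"
proof -
  have "transport \<pi> P Q - e < transport \<pi> P Q" using assms by simp
  then show ?thesis unfolding transport_def
    by (subst (asm) less_cSUP_iff[OF _ bdd_above_expectation_log_loss]) (use pair_pmf_in_couplings in auto)
qed

text \<open>The infinite branch of \<open>log_cost\<close> has probability zero under every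
  coupling, so each extended integral is an ordinary finite expectation.\<close>

lemma max_transport_eq: "max_transport (log_cost \<pi>) P Q = ennreal (transport \<pi> P Q)"
proof -
  have *: "(\<integral>\<^sup>+(x, y). log_cost \<pi> x y \<partial>measure_pmf R) = ennreal (measure_pmf.expectation R (log_loss \<pi>))"
    if R: "R \<in> couplings P Q" for R
  proof -
    have s: "set_pmf R \<subseteq> set_pmf \<pi>" using couplings_support[OF R] sub by simp
    have "(\<integral>\<^sup>+(x, y). log_cost \<pi> x y \<partial>measure_pmf R) = (\<integral>\<^sup>+z. ennreal (log_loss \<pi> z) \<partial>measure_pmf R)"
    proof (intro nn_integral_cong_AE AE_pmfI)
      fix z assume "z \<in> set_pmf R"
      then have "pmf \<pi> z > 0" using s by (auto intro: pmf_positive)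
      then show "(case z of (x, y) \<Rightarrow> log_cost \<pi> x y) = ennreal (log_loss \<pi> z)"
        by (auto simp: log_cost_def log_loss_def ln_div split: prod.split)
    qed
    also have "\<dots> = ennreal (measure_pmf.expectation R (log_loss \<pi>))"
      using finite_subset[OF s fin]
      by (intro nn_integral_eq_integral integrable_measure_pmf_finite) (auto simp: log_loss_nonneg)
    finally show ?thesis .
  qed
  show ?thesis
  proof (rule antisym)
    show "max_transport (log_cost \<pi>) P Q \<le> ennreal (transport \<pi> P Q)"
      unfolding max_transport_def by (rule SUP_least) (simp add: * expectation_le_transport ennreal_leI)
    have le: "ennreal (measure_pmf.expectation R (log_loss \<pi>)) \<le> max_transport (log_cost \<pi>) P Q"
      if "R \<in> couplings P Q" for R
      using SUP_upper[OF that, of "\<lambda>R. \<integral>\<^sup>+(x, y). log_cost \<pi> x y \<partial>measure_pmf R"]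
      by (simp add: max_transport_def *[OF that])
    show "ennreal (transport \<pi> P Q) \<le> max_transport (log_cost \<pi>) P Q"
    \<comment> \<open>If the left value is infinite there is nothing to show; a finite one bounds
      every expectation and hence their real supremum.\<close>
    proof (cases "max_transport (log_cost \<pi>) P Q")
      case (real r)
      then have "transport \<pi> P Q \<le> r"
        using le by (intro transport_le) (auto simp: ennreal_le_iff)
      then show ?thesis using real by (simp add: ennreal_leI)
    qed auto
  qed
qed

lemma Phi_eq: "Phi (log_cost \<pi>) P Q = ereal (phi \<pi> P Q)"
  by (simp add: Phi_def phi_def max_transport_eq transport_nonneg enn2ereal_ennreal)

end

section \<open>Gluing couplings\<close>

lemma map_pair_fst: "map_pmf (\<lambda>z. f (fst z)) (pair_pmf A B) = map_pmf f A"
  by (metis map_fst_pair_pmf map_pmf_comp)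

lemma map_pair_snd: "map_pmf (\<lambda>z. f (snd z)) (pair_pmf A B) = map_pmf f B"
  by (metis map_snd_pair_pmf map_pmf_comp)

text \<open>The first marginal of \<open>S y\<close> does not depend on \<open>y\<close>, and the
  second marginal of \<open>T x\<close> does not depend on \<open>x\<close>. Hence both families are
  compatible with one and the same independent pair \<open>(x, y)\<close>, and each can be completed
  from it separately.\<close>

lemma glue_couplings:
  fixes P :: "('a \<times> 'c) pmf" and Q :: "('b \<times> 'd) pmf"
  assumes S: "\<And>y. y \<in> snd ` set_pmf Q \<Longrightarrow> S y \<in> couplings (map_pmf fst P) (cond_fst Q y)"
    and T: "\<And>x. x \<in> fst ` set_pmf P \<Longrightarrow> T x \<in> couplings (cond_snd P x) (map_pmf snd Q)"
  obtains R where "R \<in> couplings P Q"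
    "map_pmf (map_prod fst fst) R = bind_pmf (map_pmf snd Q) S"
    "map_pmf (map_prod snd snd) R = bind_pmf (map_pmf fst P) T"
proof
  \<comment> \<open>Here \<open>x\<close> and \<open>y\<close> are the values of \<open>X1\<close>
    and \<open>Y2\<close>. The component \<open>fst z\<close> is \<open>Y1\<close>, drawn from
    \<open>S y\<close> given \<open>X1 = x\<close>; \<open>snd z\<close> is \<open>X2\<close>, drawn
    from \<open>T x\<close> given \<open>Y2 = y\<close>.\<close>
  define R where "R = bind_pmf (map_pmf fst P) (\<lambda>x. bind_pmf (map_pmf snd Q) (\<lambda>y.
    map_pmf (\<lambda>z. ((x, snd z), (fst z, y))) (pair_pmf (cond_snd (S y) x) (cond_fst (T x) y))))"
  have S1: "map_pmf fst (S y) = map_pmf fst P" and S2: "map_pmf snd (S y) = cond_fst Q y"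
    if "y \<in> set_pmf (map_pmf snd Q)" for y
    using S[of y] that by (auto simp: couplings_def)
  have T1: "map_pmf fst (T x) = cond_snd P x" and T2: "map_pmf snd (T x) = map_pmf snd Q"
    if "x \<in> set_pmf (map_pmf fst P)" for x
    using T[of x] that by (auto simp: couplings_def)
  have "map_pmf fst R = bind_pmf (map_pmf fst P) (\<lambda>x. map_pmf (Pair x) (bind_pmf (map_pmf snd Q) (cond_fst (T x))))"
    unfolding R_def map_bind_pmf map_pmf_comp by (simp only: fst_conv map_pair_snd)
  also have "\<dots> = bind_pmf (map_pmf fst P) (\<lambda>x. map_pmf (Pair x) (cond_snd P x))"
    \<comment> \<open>Averaging the law of \<open>X2\<close> over \<open>y\<close> recovers the
      first marginal of \<open>T x\<close>, because \<open>y\<close> has exactly the second marginal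
      of \<open>T x\<close>.\<close>
    by (intro bind_pmf_cong refl) (metis T1 T2 bind_cond_fst)
  finally have P: "map_pmf fst R = P" by (simp add: disintegrate)
  have "map_pmf snd R = bind_pmf (map_pmf snd Q) (\<lambda>y. map_pmf (\<lambda>x. (x, y)) (bind_pmf (map_pmf fst P) (cond_snd (S y))))"
    unfolding R_def map_bind_pmf map_pmf_comp
    \<comment> \<open>The draws of \<open>x\<close> and \<open>y\<close> are independent, so
      \<open>y\<close> may come first; the average over \<open>x\<close> then only involves
      \<open>S y\<close>.\<close>
    by (subst bind_commute_pmf) (simp only: snd_conv map_pair_fst[where f = "\<lambda>x. (x, _)"])
  also have "\<dots> = bind_pmf (map_pmf snd Q) (\<lambda>y. map_pmf (\<lambda>x. (x, y)) (cond_fst Q y))"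
    by (intro bind_pmf_cong refl) (metis S1 S2 bind_cond_snd)
  finally have Q: "map_pmf snd R = Q" by (simp add: disintegrate')
  show "R \<in> couplings P Q" using P Q by (simp add: couplings_def)
  have "map_pmf (map_prod fst fst) R
      = bind_pmf (map_pmf snd Q) (\<lambda>y. bind_pmf (map_pmf fst P) (\<lambda>x. map_pmf (Pair x) (cond_snd (S y) x)))"
    unfolding R_def map_bind_pmf map_pmf_comp
    by (subst bind_commute_pmf) (simp only: map_prod_simp fst_conv snd_conv map_pair_fst)
  also have "\<dots> = bind_pmf (map_pmf snd Q) S"
    by (intro bind_pmf_cong refl) (metis S1 disintegrate)
  finally show "map_pmf (map_prod fst fst) R = bind_pmf (map_pmf snd Q) S" .
  have "map_pmf (map_prod snd snd) R
      = bind_pmf (map_pmf fst P) (\<lambda>x. bind_pmf (map_pmf snd Q) (\<lambda>y. map_pmf (\<lambda>a. (a, y)) (cond_fst (T x) y)))"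
    unfolding R_def map_bind_pmf map_pmf_comp
    by (simp only: map_prod_simp fst_conv snd_conv map_pair_snd[where f = "\<lambda>x. (x, _)"])
  also have "\<dots> = bind_pmf (map_pmf fst P) T"
    by (intro bind_pmf_cong refl) (metis T2 disintegrate')
  finally show "map_pmf (map_prod snd snd) R = bind_pmf (map_pmf fst P) T" .
qed

section \<open>Product sources\<close>

lemma inj_shuffle: "inj (\<lambda>((x1, y1), (x2, y2)). ((x1, x2), (y1, y2)))"
  by (auto simp: inj_def)

lemma pmf_prod_source: "pmf (prod_source \<pi>\<^sub>1 \<pi>\<^sub>2) ((x1, x2), (y1, y2)) = pmf \<pi>\<^sub>1 (x1, y1) * pmf \<pi>\<^sub>2 (x2, y2)"
  using pmf_map_inj'[OF inj_shuffle, of "pair_pmf \<pi>\<^sub>1 \<pi>\<^sub>2" "((x1, y1), (x2, y2))"]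
  by (simp add: prod_source_def pmf_pair)

text \<open>Kernels of a decomposition group the two \<open>X\<close> parts against the two
  \<open>Y\<close> parts, while a product source groups by index; this converts between the
  groupings.\<close>

lemma pair_pair_eq_prod_source:
  "pair_pmf (pair_pmf A B) (pair_pmf C D) = prod_source (pair_pmf A C) (pair_pmf B D)"
proof (rule pmf_eqI)
  fix z :: "('a \<times> 'b) \<times> ('c \<times> 'd)"
  obtain a b c d where "z = ((a, b), (c, d))" by (metis prod.exhaust)
  then show "pmf (pair_pmf (pair_pmf A B) (pair_pmf C D)) z = pmf (prod_source (pair_pmf A C) (pair_pmf B D)) z"
    by (simp add: pmf_pair pmf_prod_source)
qed

lemma prod_source_bind:
  "prod_source (bind_pmf A f) (bind_pmf B g) = bind_pmf A (\<lambda>a. bind_pmf B (\<lambda>b. prod_source (f a) (g b)))"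
proof -
  have "pair_pmf (bind_pmf A f) (bind_pmf B g) = bind_pmf A (\<lambda>a. bind_pmf B (\<lambda>b. pair_pmf (f a) (g b)))"
    unfolding pair_pmf_def bind_assoc_pmf
    by (rule bind_pmf_cong[OF refl]) (rule bind_commute_pmf)
  then show ?thesis by (simp add: prod_source_def map_bind_pmf)
qed

lemma set_prod_source: "((x1, x2), (y1, y2)) \<in> set_pmf (prod_source \<pi>\<^sub>1 \<pi>\<^sub>2) \<longleftrightarrow>
    (x1, y1) \<in> set_pmf \<pi>\<^sub>1 \<and> (x2, y2) \<in> set_pmf \<pi>\<^sub>2"
  by (simp add: set_pmf_iff pmf_prod_source)

lemma finite_prod_source:
  "finite (set_pmf \<pi>\<^sub>1) \<Longrightarrow> finite (set_pmf \<pi>\<^sub>2) \<Longrightarrow> finite (set_pmf (prod_source \<pi>\<^sub>1 \<pi>\<^sub>2))"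
  by (simp add: prod_source_def)

lemma map_prod_fst_prod_source: "map_pmf (map_prod fst fst) (prod_source \<pi>\<^sub>1 \<pi>\<^sub>2) = \<pi>\<^sub>1"
  by (simp add: prod_source_def map_pmf_comp case_prod_unfold map_fst_pair_pmf)

lemma map_prod_snd_prod_source: "map_pmf (map_prod snd snd) (prod_source \<pi>\<^sub>1 \<pi>\<^sub>2) = \<pi>\<^sub>2"
  by (simp add: prod_source_def map_pmf_comp case_prod_unfold map_snd_pair_pmf)

text \<open>Supplies the rectangle condition for the conditional problems: \<open>x1\<close> extends
  to a point of \<open>P\<close> and \<open>(y1, y)\<close> is a point of \<open>Q\<close>, and the
  support of the source factorises.\<close>

lemma prod_source_support_fst:
  assumes sub: "set_pmf P \<times> set_pmf Q \<subseteq> set_pmf (prod_source \<pi>\<^sub>1 \<pi>\<^sub>2)" and y: "y \<in> snd ` set_pmf Q"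
  shows "set_pmf (map_pmf fst P) \<times> set_pmf (cond_fst Q y) \<subseteq> set_pmf \<pi>\<^sub>1"
proof
  fix z assume "z \<in> set_pmf (map_pmf fst P) \<times> set_pmf (cond_fst Q y)"
  then obtain x1 x2 y1 where z: "z = (x1, y1)" "(x1, x2) \<in> set_pmf P" "(y1, y) \<in> set_pmf Q"
    by (auto simp: set_cond_fst[OF y])
  then have "((x1, x2), (y1, y)) \<in> set_pmf (prod_source \<pi>\<^sub>1 \<pi>\<^sub>2)" using sub by blast
  then show "z \<in> set_pmf \<pi>\<^sub>1" by (simp add: z set_prod_source)
qed

lemma prod_source_support_snd:
  assumes sub: "set_pmf P \<times> set_pmf Q \<subseteq> set_pmf (prod_source \<pi>\<^sub>1 \<pi>\<^sub>2)" and x: "x \<in> fst ` set_pmf P"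
  shows "set_pmf (cond_snd P x) \<times> set_pmf (map_pmf snd Q) \<subseteq> set_pmf \<pi>\<^sub>2"
proof
  fix z assume "z \<in> set_pmf (cond_snd P x) \<times> set_pmf (map_pmf snd Q)"
  then obtain x2 y1 y2 where z: "z = (x2, y2)" "(x, x2) \<in> set_pmf P" "(y1, y2) \<in> set_pmf Q"
    by (auto simp: set_cond_snd[OF x])
  then have "((x, x2), (y1, y2)) \<in> set_pmf (prod_source \<pi>\<^sub>1 \<pi>\<^sub>2)" using sub by blast
  then show "z \<in> set_pmf \<pi>\<^sub>2" by (simp add: z set_prod_source)
qed

text \<open>The log of a product splits, so the cost of a coupling depends only on its two
  projections to equal indices. The correlation between these projections is free, which is what
  gluing exploits.\<close>

lemma expectation_log_loss_prod_source:
  assumes "finite (set_pmf R)" "set_pmf R \<subseteq> set_pmf (prod_source \<pi>\<^sub>1 \<pi>\<^sub>2)"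
  shows "measure_pmf.expectation R (log_loss (prod_source \<pi>\<^sub>1 \<pi>\<^sub>2)) =
    measure_pmf.expectation (map_pmf (map_prod fst fst) R) (log_loss \<pi>\<^sub>1) +
    measure_pmf.expectation (map_pmf (map_prod snd snd) R) (log_loss \<pi>\<^sub>2)"
proof -
  have "measure_pmf.expectation R (log_loss (prod_source \<pi>\<^sub>1 \<pi>\<^sub>2)) =
     measure_pmf.expectation R (\<lambda>z. log_loss \<pi>\<^sub>1 (map_prod fst fst z) + log_loss \<pi>\<^sub>2 (map_prod snd snd z))"
  proof (intro integral_cong_AE AE_pmfI)
    fix z assume z: "z \<in> set_pmf R"
    obtain x1 x2 y1 y2 where eq: "z = ((x1, x2), (y1, y2))" by (metis prod.exhaust)
    have "pmf \<pi>\<^sub>1 (x1, y1) > 0" "pmf \<pi>\<^sub>2 (x2, y2) > 0"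
      using z assms(2) unfolding eq by (auto intro!: pmf_positive simp: set_prod_source)
    then show "log_loss (prod_source \<pi>\<^sub>1 \<pi>\<^sub>2) z = log_loss \<pi>\<^sub>1 (map_prod fst fst z) + log_loss \<pi>\<^sub>2 (map_prod snd snd z)"
      by (simp add: eq log_loss_def pmf_prod_source ln_mult)
  qed auto
  then show ?thesis using assms(1) by (simp add: integrable_measure_pmf_finite)
qed

section \<open>Comparing the objective of a product with those of its factors\<close>

lemma expectation_bind_pmf_finite:
  fixes h :: "'b \<Rightarrow> real"
  assumes "finite (set_pmf p)" "\<And>x. x \<in> set_pmf p \<Longrightarrow> finite (set_pmf (f x))"
  shows "measure_pmf.expectation (bind_pmf p f) h = measure_pmf.expectation p (\<lambda>x. measure_pmf.expectation (f x) h)"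
  by (subst pmf_expectation_bind[OF assms(1)]) (use assms in \<open>auto simp: integral_measure_pmf[OF assms(1)]\<close>)

lemma expectation_mono:
  fixes f g :: "'a \<Rightarrow> real"
  assumes "finite (set_pmf p)" "\<And>x. x \<in> set_pmf p \<Longrightarrow> f x \<le> g x"
  shows "measure_pmf.expectation p f \<le> measure_pmf.expectation p g"
  using assms by (intro integral_mono_AE integrable_measure_pmf_finite AE_pmfI)

lemma transport_prod_source_ge:
  assumes fin: "finite (set_pmf \<pi>\<^sub>1)" "finite (set_pmf \<pi>\<^sub>2)"
    and sub: "set_pmf P \<times> set_pmf Q \<subseteq> set_pmf (prod_source \<pi>\<^sub>1 \<pi>\<^sub>2)"
  shows "measure_pmf.expectation (map_pmf snd Q) (\<lambda>y. transport \<pi>\<^sub>1 (map_pmf fst P) (cond_fst Q y))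
       + measure_pmf.expectation (map_pmf fst P) (\<lambda>x. transport \<pi>\<^sub>2 (cond_snd P x) (map_pmf snd Q))
       \<le> transport (prod_source \<pi>\<^sub>1 \<pi>\<^sub>2) P Q" (is "?L1 + ?L2 \<le> _")
proof (rule field_le_epsilon)
  fix e :: real assume e: "e > 0"
  note finp = finite_prod_source[OF fin]
  note finPQ = finite_supports[OF finp sub]
  have sub1: "set_pmf (map_pmf fst P) \<times> set_pmf (cond_fst Q y) \<subseteq> set_pmf \<pi>\<^sub>1" if "y \<in> snd ` set_pmf Q" for y
    by (rule prod_source_support_fst[OF sub that])
  have sub2: "set_pmf (cond_snd P x) \<times> set_pmf (map_pmf snd Q) \<subseteq> set_pmf \<pi>\<^sub>2" if "x \<in> fst ` set_pmf P" for x
    by (rule prod_source_support_snd[OF sub that])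
  \<comment> \<open>Each of the two families may lose \<open>e / 2\<close>; averaging over
    \<open>y\<close> or \<open>x\<close> keeps these losses unchanged, so the glued coupling loses
    at most \<open>e\<close>.\<close>
  have "\<exists>R\<in>couplings (map_pmf fst P) (cond_fst Q y).
      transport \<pi>\<^sub>1 (map_pmf fst P) (cond_fst Q y) - e / 2 < measure_pmf.expectation R (log_loss \<pi>\<^sub>1)"
    if "y \<in> snd ` set_pmf Q" for y
    using ex_coupling_near_transport[OF fin(1) sub1[OF that]] e by simp
  then obtain S where S: "\<And>y. y \<in> snd ` set_pmf Q \<Longrightarrow> S y \<in> couplings (map_pmf fst P) (cond_fst Q y)"
    and S': "\<And>y. y \<in> snd ` set_pmf Q \<Longrightarrow>
      transport \<pi>\<^sub>1 (map_pmf fst P) (cond_fst Q y) - e / 2 < measure_pmf.expectation (S y) (log_loss \<pi>\<^sub>1)"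
    by metis
  have "\<exists>R\<in>couplings (cond_snd P x) (map_pmf snd Q).
      transport \<pi>\<^sub>2 (cond_snd P x) (map_pmf snd Q) - e / 2 < measure_pmf.expectation R (log_loss \<pi>\<^sub>2)"
    if "x \<in> fst ` set_pmf P" for x
    using ex_coupling_near_transport[OF fin(2) sub2[OF that]] e by simp
  then obtain T where T: "\<And>x. x \<in> fst ` set_pmf P \<Longrightarrow> T x \<in> couplings (cond_snd P x) (map_pmf snd Q)"
    and T': "\<And>x. x \<in> fst ` set_pmf P \<Longrightarrow>
      transport \<pi>\<^sub>2 (cond_snd P x) (map_pmf snd Q) - e / 2 < measure_pmf.expectation (T x) (log_loss \<pi>\<^sub>2)"
    by metis
  obtain R where R: "R \<in> couplings P Q"
    "map_pmf (map_prod fst fst) R = bind_pmf (map_pmf snd Q) S"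
    "map_pmf (map_prod snd snd) R = bind_pmf (map_pmf fst P) T"
    by (rule glue_couplings[where P = P and Q = Q, OF S T])
  have finS: "finite (set_pmf (S y))" if "y \<in> snd ` set_pmf Q" for y
    using couplings_support[OF S[OF that]] sub1[OF that] fin by (meson finite_subset)
  have finT: "finite (set_pmf (T x))" if "x \<in> fst ` set_pmf P" for x
    using couplings_support[OF T[OF that]] sub2[OF that] fin by (meson finite_subset)
  have "?L1 - e / 2 = measure_pmf.expectation (map_pmf snd Q) (\<lambda>y. transport \<pi>\<^sub>1 (map_pmf fst P) (cond_fst Q y) - e / 2)"
    using finPQ by (simp add: integrable_measure_pmf_finite)
  also have "\<dots> \<le> measure_pmf.expectation (map_pmf snd Q) (\<lambda>y. measure_pmf.expectation (S y) (log_loss \<pi>\<^sub>1))"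
    using finPQ S' by (intro expectation_mono) (auto intro: less_imp_le)
  also have "\<dots> = measure_pmf.expectation (map_pmf (map_prod fst fst) R) (log_loss \<pi>\<^sub>1)"
    unfolding R(2) using finPQ finS by (subst expectation_bind_pmf_finite) auto
  finally have 1: "?L1 - e / 2 \<le> \<dots>" .
  have "?L2 - e / 2 = measure_pmf.expectation (map_pmf fst P) (\<lambda>x. transport \<pi>\<^sub>2 (cond_snd P x) (map_pmf snd Q) - e / 2)"
    using finPQ by (simp add: integrable_measure_pmf_finite)
  also have "\<dots> \<le> measure_pmf.expectation (map_pmf fst P) (\<lambda>x. measure_pmf.expectation (T x) (log_loss \<pi>\<^sub>2))"
    using finPQ T' by (intro expectation_mono) (auto intro: less_imp_le)
  also have "\<dots> = measure_pmf.expectation (map_pmf (map_prod snd snd) R) (log_loss \<pi>\<^sub>2)"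
    unfolding R(3) using finPQ finT by (subst expectation_bind_pmf_finite) auto
  finally have 2: "?L2 - e / 2 \<le> \<dots>" .
  have Rsub: "set_pmf R \<subseteq> set_pmf (prod_source \<pi>\<^sub>1 \<pi>\<^sub>2)" using couplings_support[OF R(1)] sub by simp
  show "?L1 + ?L2 \<le> transport (prod_source \<pi>\<^sub>1 \<pi>\<^sub>2) P Q + e"
    using 1 2 expectation_le_transport[OF finp sub R(1)]
      expectation_log_loss_prod_source[OF finite_subset[OF Rsub finp] Rsub] by simp
qed

text \<open>In the first average the entropy of \<open>map_pmf fst P\<close> is constant and that of
  \<open>cond_fst Q y\<close> averages to a conditional entropy; the second average holds the
  complementary terms. By the two chain rules the four add up to the entropies of \<open>P\<close>
  and \<open>Q\<close>.\<close>

lemma phi_prod_source_ge: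
  assumes fin: "finite (set_pmf \<pi>\<^sub>1)" "finite (set_pmf \<pi>\<^sub>2)"
    and sub: "set_pmf P \<times> set_pmf Q \<subseteq> set_pmf (prod_source \<pi>\<^sub>1 \<pi>\<^sub>2)"
  shows "measure_pmf.expectation (map_pmf snd Q) (\<lambda>y. phi \<pi>\<^sub>1 (map_pmf fst P) (cond_fst Q y))
       + measure_pmf.expectation (map_pmf fst P) (\<lambda>x. phi \<pi>\<^sub>2 (cond_snd P x) (map_pmf snd Q))
       \<le> phi (prod_source \<pi>\<^sub>1 \<pi>\<^sub>2) P Q"
proof -
  note finPQ = finite_supports[OF finite_prod_source[OF fin] sub]
  then show ?thesis
    using transport_prod_source_ge[OF assms] shannon_entropy_cond_snd[OF finPQ(1)] shannon_entropy_cond_fst[OF finPQ(2)]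
    by (simp add: phi_def integrable_measure_pmf_finite)
qed

text \<open>Any coupling of the pairs projects to couplings of the factors, so its cost is at most
  the sum of the two suprema, while entropies of independent pairs add exactly.\<close>

lemma phi_prod_source_pair_le:
  assumes fin: "finite (set_pmf \<pi>\<^sub>1)" "finite (set_pmf \<pi>\<^sub>2)"
    and sub1: "set_pmf P\<^sub>1 \<times> set_pmf Q\<^sub>1 \<subseteq> set_pmf \<pi>\<^sub>1"
    and sub2: "set_pmf P\<^sub>2 \<times> set_pmf Q\<^sub>2 \<subseteq> set_pmf \<pi>\<^sub>2"
  shows "phi (prod_source \<pi>\<^sub>1 \<pi>\<^sub>2) (pair_pmf P\<^sub>1 P\<^sub>2) (pair_pmf Q\<^sub>1 Q\<^sub>2) \<le> phi \<pi>\<^sub>1 P\<^sub>1 Q\<^sub>1 + phi \<pi>\<^sub>2 P\<^sub>2 Q\<^sub>2"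
proof -
  note finp = finite_prod_source[OF fin]
  have sub: "set_pmf (pair_pmf P\<^sub>1 P\<^sub>2) \<times> set_pmf (pair_pmf Q\<^sub>1 Q\<^sub>2) \<subseteq> set_pmf (prod_source \<pi>\<^sub>1 \<pi>\<^sub>2)"
    using sub1 sub2 by (auto simp: set_prod_source)
  have "transport (prod_source \<pi>\<^sub>1 \<pi>\<^sub>2) (pair_pmf P\<^sub>1 P\<^sub>2) (pair_pmf Q\<^sub>1 Q\<^sub>2) \<le> transport \<pi>\<^sub>1 P\<^sub>1 Q\<^sub>1 + transport \<pi>\<^sub>2 P\<^sub>2 Q\<^sub>2"
  proof (rule transport_le[OF finp sub])
    fix R assume R: "R \<in> couplings (pair_pmf P\<^sub>1 P\<^sub>2) (pair_pmf Q\<^sub>1 Q\<^sub>2)"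
    have Rsub: "set_pmf R \<subseteq> set_pmf (prod_source \<pi>\<^sub>1 \<pi>\<^sub>2)" using couplings_support[OF R] sub by simp
    have "map_pmf fst (map_pmf fst R) = P\<^sub>1" "map_pmf snd (map_pmf fst R) = P\<^sub>2"
      "map_pmf fst (map_pmf snd R) = Q\<^sub>1" "map_pmf snd (map_pmf snd R) = Q\<^sub>2"
      using R by (simp_all add: couplings_def map_fst_pair_pmf map_snd_pair_pmf del: map_pmf_comp)
    then have "map_pmf (map_prod fst fst) R \<in> couplings P\<^sub>1 Q\<^sub>1" "map_pmf (map_prod snd snd) R \<in> couplings P\<^sub>2 Q\<^sub>2"
      by (simp_all add: couplings_def map_pmf_comp)
    then show "measure_pmf.expectation R (log_loss (prod_source \<pi>\<^sub>1 \<pi>\<^sub>2)) \<le> transport \<pi>\<^sub>1 P\<^sub>1 Q\<^sub>1 + transport \<pi>\<^sub>2 P\<^sub>2 Q\<^sub>2"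
      unfolding expectation_log_loss_prod_source[OF finite_subset[OF Rsub finp] Rsub]
      by (intro add_mono expectation_le_transport fin sub1 sub2)
  qed
  then show ?thesis
    using finite_supports[OF fin(1) sub1] finite_supports[OF fin(2) sub2]
    by (simp add: phi_def shannon_entropy_pair)
qed


section \<open>Gamma as a finite real infimum\<close>

text \<open>Conditional independence makes the support given \<open>w\<close> a rectangle. This is
  what provides the standing assumption on \<open>P\<close> and \<open>Q\<close> for every kernel of
  a decomposition.\<close>

lemma decomposition_support:
  assumes "bind_pmf PW (\<lambda>w. pair_pmf (PX w) (PY w)) = \<pi>" "w \<in> set_pmf PW"
  shows "set_pmf (PX w) \<times> set_pmf (PY w) \<subseteq> set_pmf \<pi>"
  using assms by auto

lemma Gamma_objective_eq:
  assumes "finite (set_pmf \<pi>)" "finite (set_pmf PW)" "bind_pmf PW (\<lambda>w. pair_pmf (PX w) (PY w)) = \<pi>"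
  shows "(\<Sum>w\<in>set_pmf PW. ereal (pmf PW w) * Phi (log_cost \<pi>) (PX w) (PY w)) =
    ereal (measure_pmf.expectation PW (\<lambda>w. phi \<pi> (PX w) (PY w)))"
proof -
  have "(\<Sum>w\<in>set_pmf PW. ereal (pmf PW w) * Phi (log_cost \<pi>) (PX w) (PY w)) =
      (\<Sum>w\<in>set_pmf PW. ereal (pmf PW w * phi \<pi> (PX w) (PY w)))"
    using Phi_eq[OF assms(1) decomposition_support[OF assms(3)]] by (intro sum.cong) auto
  also have "\<dots> = ereal (measure_pmf.expectation PW (\<lambda>w. phi \<pi> (PX w) (PY w)))"
    by (subst integral_measure_pmf[OF assms(2)]) auto
  finally show ?thesis .
qed

text \<open>Admits auxiliary variables of any type by numbering their finite support, so that pairs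
  can serve as \<open>W\<close> below.\<close>

lemma Gamma_src_le:
  fixes PW :: "'w pmf"
  assumes "finite (set_pmf \<pi>)" "finite (set_pmf PW)" "bind_pmf PW (\<lambda>w. pair_pmf (PX w) (PY w)) = \<pi>"
  shows "Gamma_src \<pi> \<le> ereal (measure_pmf.expectation PW (\<lambda>w. phi \<pi> (PX w) (PY w)))"
proof -
  obtain f :: "'w \<Rightarrow> nat" where f: "inj_on f (set_pmf PW)"
    using finite_imp_inj_to_nat_seg[OF assms(2)] by blast
  define g where "g = inv_into (set_pmf PW) f"
  have g: "g (f w) = w" if "w \<in> set_pmf PW" for w using that f by (simp add: g_def)
  have fin: "finite (set_pmf (map_pmf f PW))" using assms(2) by simp
  have d: "bind_pmf (map_pmf f PW) (\<lambda>w. pair_pmf (PX (g w)) (PY (g w))) = \<pi>"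
    unfolding bind_map_pmf assms(3)[symmetric] by (intro bind_pmf_cong refl) (simp add: g)
  have "measure_pmf.expectation (map_pmf f PW) (\<lambda>w. phi \<pi> (PX (g w)) (PY (g w)))
      = measure_pmf.expectation PW (\<lambda>w. phi \<pi> (PX w) (PY w))"
    unfolding integral_map_pmf by (intro integral_cong_AE AE_pmfI) (simp_all add: g)
  moreover have "(map_pmf f PW, PX \<circ> g, PY \<circ> g) \<in> cond_indep_decomps \<pi>"
    using d fin by (simp add: cond_indep_decomps_def)
  from INF_lower[OF this, of "\<lambda>(PW, PX, PY). \<Sum>w\<in>set_pmf PW. ereal (pmf PW w) * Phi (log_cost \<pi>) (PX w) (PY w)"]
  have "Gamma_src \<pi> \<le> (\<Sum>w\<in>set_pmf (map_pmf f PW). ereal (pmf (map_pmf f PW) w) * Phi (log_cost \<pi>) (PX (g w)) (PY (g w)))"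
    by (simp add: Gamma_src_def)
  ultimately show ?thesis using Gamma_objective_eq[OF assms(1) fin d] by simp
qed

text \<open>The transport term is nonnegative and each entropy is at most the size of a projection
  of the support of \<open>\<pi>\<close>. The bound is uniform in \<open>P\<close> and
  \<open>Q\<close>, hence survives the infimum.\<close>

lemma phi_ge:
  assumes fin: "finite (set_pmf \<pi>)" and sub: "set_pmf P \<times> set_pmf Q \<subseteq> set_pmf \<pi>"
  shows "phi \<pi> P Q \<ge> - 2 * real (card (set_pmf \<pi>))"
proof -
  have "set_pmf P \<subseteq> fst ` set_pmf \<pi>" "set_pmf Q \<subseteq> snd ` set_pmf \<pi>"
    using sub set_pmf_not_empty[of P] set_pmf_not_empty[of Q] by force+
  then have "card (set_pmf P) \<le> card (set_pmf \<pi>)" "card (set_pmf Q) \<le> card (set_pmf \<pi>)"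
    using fin by (meson card_image_le card_mono finite_imageI order_trans)+
  then show ?thesis
    using transport_nonneg[OF fin sub] shannon_entropy_le_card[of P] shannon_entropy_le_card[of Q]
    by (simp add: phi_def)
qed

text \<open>\<open>real_of_ereal\<close> sends infinite values to 0, so this carries information
  only once \<open>Gamma_src\<close> is known to be finite.\<close>

definition gamma :: "('a \<times> 'b) pmf \<Rightarrow> real" where
  "gamma \<pi> = real_of_ereal (Gamma_src \<pi>)"

lemma Gamma_src_eq:
  assumes fin: "finite (set_pmf \<pi>)"
  shows "Gamma_src \<pi> = ereal (gamma \<pi>)"
proof -
  \<comment> \<open>Taking \<open>W = (X, Y)\<close> with deterministic kernels shows that
    decompositions exist, so the infimum is not plus infinity.\<close>
  have "bind_pmf \<pi> (\<lambda>w. pair_pmf (return_pmf (fst w)) (return_pmf (snd w))) = \<pi>"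
    by (simp add: bind_return_pmf')
  from Gamma_src_le[OF fin fin this] have "Gamma_src \<pi> \<noteq> \<infinity>" by auto
  moreover have "ereal (- 2 * real (card (set_pmf \<pi>))) \<le> Gamma_src \<pi>"
    unfolding Gamma_src_def
  proof (rule INF_greatest, clarify)
    fix PW PX PY assume "(PW, PX, PY) \<in> cond_indep_decomps \<pi>"
    then have d: "finite (set_pmf PW)" "bind_pmf PW (\<lambda>w. pair_pmf (PX w) (PY w)) = \<pi>"
      by (auto simp: cond_indep_decomps_def)
    have "- 2 * real (card (set_pmf \<pi>)) = measure_pmf.expectation PW (\<lambda>w. - 2 * real (card (set_pmf \<pi>)))"
      by simp
    also have "\<dots> \<le> measure_pmf.expectation PW (\<lambda>w. phi \<pi> (PX w) (PY w))"
      by (intro expectation_mono d phi_ge fin decomposition_support[OF d(2)])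
    finally show "ereal (- 2 * real (card (set_pmf \<pi>))) \<le>
        (\<Sum>w\<in>set_pmf PW. ereal (pmf PW w) * Phi (log_cost \<pi>) (PX w) (PY w))"
      by (simp add: Gamma_objective_eq[OF fin d])
  qed
  then have "Gamma_src \<pi> \<noteq> - \<infinity>" by auto
  ultimately show ?thesis unfolding gamma_def by (cases "Gamma_src \<pi>") auto
qed

lemma gamma_le:
  assumes "finite (set_pmf \<pi>)" "finite (set_pmf PW)" "bind_pmf PW (\<lambda>w. pair_pmf (PX w) (PY w)) = \<pi>"
  shows "gamma \<pi> \<le> measure_pmf.expectation PW (\<lambda>w. phi \<pi> (PX w) (PY w))"
  using Gamma_src_le[OF assms] Gamma_src_eq[OF assms(1)] by simp

lemma gamma_approx:
  assumes fin: "finite (set_pmf \<pi>)" and "e > 0"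
  obtains PW :: "nat pmf" and PX PY where "finite (set_pmf PW)"
    "bind_pmf PW (\<lambda>w. pair_pmf (PX w) (PY w)) = \<pi>"
    "measure_pmf.expectation PW (\<lambda>w. phi \<pi> (PX w) (PY w)) < gamma \<pi> + e"
proof -
  have "Gamma_src \<pi> < ereal (gamma \<pi> + e)" using Gamma_src_eq[OF fin] \<open>e > 0\<close> by simp
  then obtain PW PX PY where *: "(PW, PX, PY) \<in> cond_indep_decomps \<pi>"
    "(\<Sum>w\<in>set_pmf PW. ereal (pmf PW w) * Phi (log_cost \<pi>) (PX w) (PY w)) < ereal (gamma \<pi> + e)"
    unfolding Gamma_src_def INF_less_iff by auto
  then have d: "finite (set_pmf PW)" "bind_pmf PW (\<lambda>w. pair_pmf (PX w) (PY w)) = \<pi>"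
    by (auto simp: cond_indep_decomps_def)
  with * show ?thesis by (intro that[OF d]) (simp add: Gamma_objective_eq[OF fin d])
qed

section \<open>Additivity on product sources\<close>

lemma gamma_prod_source_le:
  assumes fin: "finite (set_pmf \<pi>\<^sub>1)" "finite (set_pmf \<pi>\<^sub>2)"
  shows "gamma (prod_source \<pi>\<^sub>1 \<pi>\<^sub>2) \<le> gamma \<pi>\<^sub>1 + gamma \<pi>\<^sub>2"
proof (rule field_le_epsilon)
  fix e :: real assume "e > 0"
  then have e: "e / 2 > 0" by simp
  obtain PW\<^sub>1 :: "nat pmf" and PX\<^sub>1 PY\<^sub>1 where d1: "finite (set_pmf PW\<^sub>1)"
    "bind_pmf PW\<^sub>1 (\<lambda>w. pair_pmf (PX\<^sub>1 w) (PY\<^sub>1 w)) = \<pi>\<^sub>1"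
    "measure_pmf.expectation PW\<^sub>1 (\<lambda>w. phi \<pi>\<^sub>1 (PX\<^sub>1 w) (PY\<^sub>1 w)) < gamma \<pi>\<^sub>1 + e / 2"
    by (rule gamma_approx[OF fin(1) e])
  obtain PW\<^sub>2 :: "nat pmf" and PX\<^sub>2 PY\<^sub>2 where d2: "finite (set_pmf PW\<^sub>2)"
    "bind_pmf PW\<^sub>2 (\<lambda>w. pair_pmf (PX\<^sub>2 w) (PY\<^sub>2 w)) = \<pi>\<^sub>2"
    "measure_pmf.expectation PW\<^sub>2 (\<lambda>w. phi \<pi>\<^sub>2 (PX\<^sub>2 w) (PY\<^sub>2 w)) < gamma \<pi>\<^sub>2 + e / 2"
    by (rule gamma_approx[OF fin(2) e])
  \<comment> \<open>The two near-optimal auxiliary variables are taken independent, and each kernel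
    is the product of the kernels of the factors.\<close>
  define PX where "PX = (\<lambda>w. pair_pmf (PX\<^sub>1 (fst w)) (PX\<^sub>2 (snd w)))"
  define PY where "PY = (\<lambda>w. pair_pmf (PY\<^sub>1 (fst w)) (PY\<^sub>2 (snd w)))"
  let ?PW = "pair_pmf PW\<^sub>1 PW\<^sub>2"
  have finW: "finite (set_pmf ?PW)" using d1 d2 by simp
  have "bind_pmf ?PW (\<lambda>w. pair_pmf (PX w) (PY w)) =
      bind_pmf PW\<^sub>1 (\<lambda>w\<^sub>1. bind_pmf PW\<^sub>2 (\<lambda>w\<^sub>2. prod_source (pair_pmf (PX\<^sub>1 w\<^sub>1) (PY\<^sub>1 w\<^sub>1)) (pair_pmf (PX\<^sub>2 w\<^sub>2) (PY\<^sub>2 w\<^sub>2))))"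
    by (simp add: PX_def PY_def pair_pair_eq_prod_source pair_pmf_def[of PW\<^sub>1] bind_assoc_pmf bind_return_pmf)
  also have "\<dots> = prod_source \<pi>\<^sub>1 \<pi>\<^sub>2"
    by (simp add: prod_source_bind d1(2)[symmetric] d2(2)[symmetric])
  finally have d: "bind_pmf ?PW (\<lambda>w. pair_pmf (PX w) (PY w)) = prod_source \<pi>\<^sub>1 \<pi>\<^sub>2" .
  have "gamma (prod_source \<pi>\<^sub>1 \<pi>\<^sub>2) \<le> measure_pmf.expectation ?PW (\<lambda>w. phi (prod_source \<pi>\<^sub>1 \<pi>\<^sub>2) (PX w) (PY w))"
    by (rule gamma_le[OF finite_prod_source[OF fin] finW d])
  also have "\<dots> \<le> measure_pmf.expectation ?PW (\<lambda>w. phi \<pi>\<^sub>1 (PX\<^sub>1 (fst w)) (PY\<^sub>1 (fst w)) + phi \<pi>\<^sub>2 (PX\<^sub>2 (snd w)) (PY\<^sub>2 (snd w)))"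
    unfolding PX_def PY_def
    by (intro expectation_mono finW phi_prod_source_pair_le fin
        decomposition_support[OF d1(2)] decomposition_support[OF d2(2)]) auto
  also have "\<dots> = measure_pmf.expectation PW\<^sub>1 (\<lambda>w. phi \<pi>\<^sub>1 (PX\<^sub>1 w) (PY\<^sub>1 w)) +
      measure_pmf.expectation PW\<^sub>2 (\<lambda>w. phi \<pi>\<^sub>2 (PX\<^sub>2 w) (PY\<^sub>2 w))"
    using finW expectation_pair_pmf_fst[of PW\<^sub>1 PW\<^sub>2 "\<lambda>w. phi \<pi>\<^sub>1 (PX\<^sub>1 w) (PY\<^sub>1 w)"]
      expectation_pair_pmf_snd[of PW\<^sub>1 PW\<^sub>2 "\<lambda>w. phi \<pi>\<^sub>2 (PX\<^sub>2 w) (PY\<^sub>2 w)"]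
    by (subst Bochner_Integration.integral_add) (auto intro: integrable_measure_pmf_finite)
  finally show "gamma (prod_source \<pi>\<^sub>1 \<pi>\<^sub>2) \<le> gamma \<pi>\<^sub>1 + gamma \<pi>\<^sub>2 + e" using d1(3) d2(3) by simp
qed

lemma gamma_prod_source_ge:
  assumes fin: "finite (set_pmf \<pi>\<^sub>1)" "finite (set_pmf \<pi>\<^sub>2)"
  shows "gamma \<pi>\<^sub>1 + gamma \<pi>\<^sub>2 \<le> gamma (prod_source \<pi>\<^sub>1 \<pi>\<^sub>2)"
proof (rule field_le_epsilon)
  fix e :: real assume e: "e > 0"
  note finp = finite_prod_source[OF fin]
  obtain PW :: "nat pmf" and PX PY where d: "finite (set_pmf PW)"
    "bind_pmf PW (\<lambda>w. pair_pmf (PX w) (PY w)) = prod_source \<pi>\<^sub>1 \<pi>\<^sub>2"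
    "measure_pmf.expectation PW (\<lambda>w. phi (prod_source \<pi>\<^sub>1 \<pi>\<^sub>2) (PX w) (PY w)) < gamma (prod_source \<pi>\<^sub>1 \<pi>\<^sub>2) + e"
    by (rule gamma_approx[OF finp e])
  note sub = decomposition_support[OF d(2)]
  note finXY = finite_supports[OF finp sub]
  define W\<^sub>1 where "W\<^sub>1 = bind_pmf PW (\<lambda>w. map_pmf (Pair w) (map_pmf snd (PY w)))"
  define W\<^sub>2 where "W\<^sub>2 = bind_pmf PW (\<lambda>w. map_pmf (Pair w) (map_pmf fst (PX w)))"
  have finW: "finite (set_pmf W\<^sub>1)" "finite (set_pmf W\<^sub>2)" using d(1) finXY by (auto simp: W\<^sub>1_def W\<^sub>2_def)
  have b1: "bind_pmf W\<^sub>1 (\<lambda>(w, y). pair_pmf (map_pmf fst (PX w)) (cond_fst (PY w) y)) = \<pi>\<^sub>1"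
  proof -
    \<comment> \<open>For fixed \<open>w\<close>, revealing \<open>Y2\<close> leaves the law of
      \<open>X1\<close> unchanged by conditional independence; averaging \<open>Y1\<close> given
      \<open>Y2\<close> gives back the law of \<open>Y1\<close>.\<close>
    have "bind_pmf (map_pmf snd Q) (\<lambda>y. pair_pmf (map_pmf fst P) (cond_fst Q y)) = map_pmf (map_prod fst fst) (pair_pmf P Q)" for P :: "('a \<times> 'c) pmf" and Q :: "('b \<times> 'd) pmf"
    proof -
      have "bind_pmf (map_pmf snd Q) (\<lambda>y. pair_pmf (map_pmf fst P) (cond_fst Q y)) = pair_pmf (map_pmf fst P) (bind_pmf (map_pmf snd Q) (cond_fst Q))"
        unfolding pair_pmf_def by (subst bind_commute_pmf) (simp add: bind_assoc_pmf)
      also have "\<dots> = map_pmf (map_prod fst fst) (pair_pmf P Q)"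
        by (simp add: bind_cond_fst map_pair[symmetric] map_prod_def)
      finally show ?thesis .
    qed
    then have "bind_pmf W\<^sub>1 (\<lambda>(w, y). pair_pmf (map_pmf fst (PX w)) (cond_fst (PY w) y))
       = map_pmf (map_prod fst fst) (bind_pmf PW (\<lambda>w. pair_pmf (PX w) (PY w)))"
      by (simp add: W\<^sub>1_def bind_assoc_pmf bind_map_pmf map_bind_pmf)
    then show ?thesis by (simp add: d(2) map_prod_fst_prod_source)
  qed
  have b2: "bind_pmf W\<^sub>2 (\<lambda>(w, x). pair_pmf (cond_snd (PX w) x) (map_pmf snd (PY w))) = \<pi>\<^sub>2"
  proof -
    \<comment> \<open>The mirror image: revealing \<open>X1\<close> affects only
      \<open>X2\<close>.\<close>
    have "bind_pmf (map_pmf fst P) (\<lambda>x. pair_pmf (cond_snd P x) (map_pmf snd Q)) = map_pmf (map_prod snd snd) (pair_pmf P Q)" for P :: "('a \<times> 'c) pmf" and Q :: "('b \<times> 'd) pmf"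
    proof -
      have "bind_pmf (map_pmf fst P) (\<lambda>x. pair_pmf (cond_snd P x) (map_pmf snd Q)) = pair_pmf (bind_pmf (map_pmf fst P) (cond_snd P)) (map_pmf snd Q)"
        unfolding pair_pmf_def by (simp add: bind_assoc_pmf)
      also have "\<dots> = map_pmf (map_prod snd snd) (pair_pmf P Q)"
        by (simp add: bind_cond_snd map_pair[symmetric] map_prod_def)
      finally show ?thesis .
    qed
    then have "bind_pmf W\<^sub>2 (\<lambda>(w, x). pair_pmf (cond_snd (PX w) x) (map_pmf snd (PY w)))
       = map_pmf (map_prod snd snd) (bind_pmf PW (\<lambda>w. pair_pmf (PX w) (PY w)))"
      by (simp add: W\<^sub>2_def bind_assoc_pmf bind_map_pmf map_bind_pmf)
    then show ?thesis by (simp add: d(2) map_prod_snd_prod_source)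
  qed
  have "gamma \<pi>\<^sub>1 \<le> measure_pmf.expectation W\<^sub>1 (\<lambda>(w, y). phi \<pi>\<^sub>1 (map_pmf fst (PX w)) (cond_fst (PY w) y))"
    using gamma_le[OF fin(1) finW(1) b1[unfolded case_prod_unfold]] by (simp add: case_prod_unfold)
  \<comment> \<open>The tower property over \<open>w\<close> and then \<open>Y2\<close> given
    \<open>w\<close> brings the bound to the form of \<open>phi_prod_source_ge\<close>, which is
    applied for each \<open>w\<close>.\<close>
  also have "\<dots> = measure_pmf.expectation PW (\<lambda>w. measure_pmf.expectation (map_pmf snd (PY w)) (\<lambda>y. phi \<pi>\<^sub>1 (map_pmf fst (PX w)) (cond_fst (PY w) y)))"
    unfolding W\<^sub>1_def using d(1) finXY by (subst expectation_bind_pmf_finite) auto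
  finally have 1: "gamma \<pi>\<^sub>1 \<le> \<dots>" .
  have "gamma \<pi>\<^sub>2 \<le> measure_pmf.expectation W\<^sub>2 (\<lambda>(w, x). phi \<pi>\<^sub>2 (cond_snd (PX w) x) (map_pmf snd (PY w)))"
    using gamma_le[OF fin(2) finW(2) b2[unfolded case_prod_unfold]] by (simp add: case_prod_unfold)
  also have "\<dots> = measure_pmf.expectation PW (\<lambda>w. measure_pmf.expectation (map_pmf fst (PX w)) (\<lambda>x. phi \<pi>\<^sub>2 (cond_snd (PX w) x) (map_pmf snd (PY w))))"
    unfolding W\<^sub>2_def using d(1) finXY by (subst expectation_bind_pmf_finite) auto
  finally have 2: "gamma \<pi>\<^sub>2 \<le> \<dots>" .
  have "gamma \<pi>\<^sub>1 + gamma \<pi>\<^sub>2 \<le> measure_pmf.expectation PW (\<lambda>w.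
      measure_pmf.expectation (map_pmf snd (PY w)) (\<lambda>y. phi \<pi>\<^sub>1 (map_pmf fst (PX w)) (cond_fst (PY w) y)) +
      measure_pmf.expectation (map_pmf fst (PX w)) (\<lambda>x. phi \<pi>\<^sub>2 (cond_snd (PX w) x) (map_pmf snd (PY w))))"
    using add_mono[OF 1 2] d(1)
    by (subst Bochner_Integration.integral_add) (auto intro: integrable_measure_pmf_finite)
  also have "\<dots> \<le> measure_pmf.expectation PW (\<lambda>w. phi (prod_source \<pi>\<^sub>1 \<pi>\<^sub>2) (PX w) (PY w))"
    by (intro expectation_mono d(1) phi_prod_source_ge fin sub)
  finally show "gamma \<pi>\<^sub>1 + gamma \<pi>\<^sub>2 \<le> gamma (prod_source \<pi>\<^sub>1 \<pi>\<^sub>2) + e" using d(3) by simp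
qed

lemma gamma_prod_source:
  "finite (set_pmf \<pi>\<^sub>1) \<Longrightarrow> finite (set_pmf \<pi>\<^sub>2) \<Longrightarrow> gamma (prod_source \<pi>\<^sub>1 \<pi>\<^sub>2) = gamma \<pi>\<^sub>1 + gamma \<pi>\<^sub>2"
  by (intro antisym gamma_prod_source_le gamma_prod_source_ge)

section \<open>Invariance under relabelling\<close>

text \<open>Couplings of the images pull back along the inverse relabellings to couplings of
  \<open>P\<close> and \<open>Q\<close> of equal cost, and injective maps preserve entropy. One
  inequality suffices, as the inverse maps give the other.\<close>

lemma phi_map_prod_le:
  assumes fin: "finite (set_pmf \<pi>)" and sub: "set_pmf P \<times> set_pmf Q \<subseteq> set_pmf \<pi>"
    and f: "inj_on f (fst ` set_pmf \<pi>)" and g: "inj_on g (snd ` set_pmf \<pi>)"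
  shows "phi (map_pmf (map_prod f g) \<pi>) (map_pmf f P) (map_pmf g Q) \<le> phi \<pi> P Q"
proof -
  define f' where "f' = inv_into (fst ` set_pmf \<pi>) f"
  define g' where "g' = inv_into (snd ` set_pmf \<pi>) g"
  have PQ: "set_pmf P \<subseteq> fst ` set_pmf \<pi>" "set_pmf Q \<subseteq> snd ` set_pmf \<pi>"
    using sub set_pmf_not_empty[of P] set_pmf_not_empty[of Q] by force+
  have f': "f' (f x) = x" if "x \<in> set_pmf P" for x
    unfolding f'_def using that PQ by (intro inv_into_f_f f) auto
  have g': "g' (g y) = y" if "y \<in> set_pmf Q" for y
    unfolding g'_def using that PQ by (intro inv_into_f_f g) auto
  have fg: "inj_on (map_prod f g) (set_pmf \<pi>)"
    by (rule inj_on_subset[OF map_prod_inj_on[OF f g]]) force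
  have sub': "set_pmf (map_pmf f P) \<times> set_pmf (map_pmf g Q) \<subseteq> set_pmf (map_pmf (map_prod f g) \<pi>)"
    using sub by force
  have "transport (map_pmf (map_prod f g) \<pi>) (map_pmf f P) (map_pmf g Q) \<le> transport \<pi> P Q"
  proof (rule transport_le[OF _ sub'])
    fix R assume R: "R \<in> couplings (map_pmf f P) (map_pmf g Q)"
    let ?R = "map_pmf (map_prod f' g') R"
    have "map_pmf f' (map_pmf f P) = map_pmf id P" "map_pmf g' (map_pmf g Q) = map_pmf id Q"
      unfolding map_pmf_comp by (intro map_pmf_cong; simp add: f' g')+
    moreover have "map_pmf fst ?R = map_pmf f' (map_pmf fst R)" "map_pmf snd ?R = map_pmf g' (map_pmf snd R)"
      by (simp_all add: map_pmf_comp)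
    ultimately have "?R \<in> couplings P Q" using R by (simp add: couplings_def)
    from expectation_le_transport[OF fin sub this]
    have "measure_pmf.expectation R (\<lambda>z. log_loss \<pi> (map_prod f' g' z)) \<le> transport \<pi> P Q" by simp
    also have "measure_pmf.expectation R (\<lambda>z. log_loss \<pi> (map_prod f' g' z)) =
       measure_pmf.expectation R (log_loss (map_pmf (map_prod f g) \<pi>))"
    proof (intro integral_cong_AE AE_pmfI)
      fix z assume "z \<in> set_pmf R"
      then obtain x y where z: "z = (f x, g y)" "x \<in> set_pmf P" "y \<in> set_pmf Q"
        using couplings_support[OF R] by auto
      then have "(x, y) \<in> set_pmf \<pi>" using sub by auto
      from pmf_map_inj[OF fg this]
      show "log_loss \<pi> (map_prod f' g' z) = log_loss (map_pmf (map_prod f g) \<pi>) z"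
        using z by (simp add: log_loss_def f' g')
    qed auto
    finally show "measure_pmf.expectation R (log_loss (map_pmf (map_prod f g) \<pi>)) \<le> transport \<pi> P Q" .
  qed (use fin in simp)
  then show ?thesis
    using inj_on_subset[OF f PQ(1)] inj_on_subset[OF g PQ(2)] by (simp add: phi_def shannon_entropy_map_inj)
qed

lemma gamma_map_prod_le:
  assumes fin: "finite (set_pmf \<pi>)"
    and f: "inj_on f (fst ` set_pmf \<pi>)" and g: "inj_on g (snd ` set_pmf \<pi>)"
  shows "gamma (map_pmf (map_prod f g) \<pi>) \<le> gamma \<pi>"
proof (rule field_le_epsilon)
  fix e :: real assume e: "e > 0"
  obtain PW :: "nat pmf" and PX PY where d: "finite (set_pmf PW)"
    "bind_pmf PW (\<lambda>w. pair_pmf (PX w) (PY w)) = \<pi>"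
    "measure_pmf.expectation PW (\<lambda>w. phi \<pi> (PX w) (PY w)) < gamma \<pi> + e"
    by (rule gamma_approx[OF fin e])
  have "bind_pmf PW (\<lambda>w. pair_pmf (map_pmf f (PX w)) (map_pmf g (PY w))) = map_pmf (map_prod f g) \<pi>"
    by (simp add: d(2)[symmetric] map_bind_pmf map_pair[symmetric] map_prod_def)
  then have "gamma (map_pmf (map_prod f g) \<pi>) \<le>
      measure_pmf.expectation PW (\<lambda>w. phi (map_pmf (map_prod f g) \<pi>) (map_pmf f (PX w)) (map_pmf g (PY w)))"
    using fin d(1) by (intro gamma_le) auto
  also have "\<dots> \<le> measure_pmf.expectation PW (\<lambda>w. phi \<pi> (PX w) (PY w))"
    by (intro expectation_mono d(1) phi_map_prod_le fin decomposition_support[OF d(2)] f g)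
  finally show "gamma (map_pmf (map_prod f g) \<pi>) \<le> gamma \<pi> + e" using d(3) by simp
qed

lemma gamma_map_prod:
  assumes fin: "finite (set_pmf \<pi>)"
    and f: "inj_on f (fst ` set_pmf \<pi>)" and g: "inj_on g (snd ` set_pmf \<pi>)"
  shows "gamma (map_pmf (map_prod f g) \<pi>) = gamma \<pi>"
\<comment> \<open>The reverse inequality applies \<open>gamma_map_prod_le\<close> to the relabelled
  source and the inverse maps, which are injective on its alphabets \<open>f\<close> fst
  \<open>set_pmf \<pi>\<close> and \<open>g\<close> snd \<open>set_pmf \<pi>\<close>.\<close>
proof (rule antisym)
  define f' where "f' = inv_into (fst ` set_pmf \<pi>) f"
  define g' where "g' = inv_into (snd ` set_pmf \<pi>) g"
  have "map_pmf (map_prod f' g') (map_pmf (map_prod f g) \<pi>) = map_pmf id \<pi>"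
    unfolding map_pmf_comp
    by (intro map_pmf_cong refl)
       (simp add: f'_def g'_def inv_into_f_f[OF f] inv_into_f_f[OF g] map_prod_def case_prod_unfold)
  moreover have "fst ` set_pmf (map_pmf (map_prod f g) \<pi>) = f ` fst ` set_pmf \<pi>"
    "snd ` set_pmf (map_pmf (map_prod f g) \<pi>) = g ` snd ` set_pmf \<pi>" by force+
  ultimately show "gamma \<pi> \<le> gamma (map_pmf (map_prod f g) \<pi>)"
    using gamma_map_prod_le[of "map_pmf (map_prod f g) \<pi>" f' g'] fin
    by (simp add: f'_def g'_def inj_on_inv_into)
qed (rule gamma_map_prod_le[OF assms])

section \<open>Powers of a source\<close>

lemma source_power_1: "source_power (Suc 0) \<pi> = map_pmf (map_prod (\<lambda>x. [x]) (\<lambda>y. [y])) \<pi>"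
  by (simp add: source_power_def map_pmf_def bind_assoc_pmf bind_return_pmf case_prod_unfold map_prod_def)

text \<open>Prepending a letter is an injective relabelling of pairs by lists, so the power differs
  from a product source only up to \<open>gamma_map_prod\<close>.\<close>

lemma source_power_Suc: "source_power (Suc n) \<pi> =
    map_pmf (map_prod (\<lambda>(x, xs). x # xs) (\<lambda>(y, ys). y # ys)) (prod_source \<pi> (source_power n \<pi>))"
  by (simp add: source_power_def prod_source_def pair_pmf_def map_pmf_def bind_assoc_pmf
      bind_return_pmf case_prod_unfold)

text \<open>Finiteness is carried through the induction because additivity requires it of the
  smaller power. The base case is \<open>n = 1\<close>, the source relabelled by singleton
  lists.\<close>

lemma gamma_source_power:
  assumes fin: "finite (set_pmf \<pi>)" and "n > 0"
  shows "finite (set_pmf (source_power n \<pi>)) \<and> gamma (source_power n \<pi>) = real n * gamma \<pi>"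
  using \<open>n > 0\<close>
proof (induction n rule: nat_induct_non_zero)
  case 1
  then show ?case using fin by (simp add: source_power_1 gamma_map_prod inj_on_def)
next
  case (Suc n)
  have "gamma (source_power (Suc n) \<pi>) = gamma (prod_source \<pi> (source_power n \<pi>))"
    unfolding source_power_Suc using fin Suc
    by (intro gamma_map_prod finite_prod_source) (auto simp: inj_on_def)
  then show ?case
    using fin Suc by (simp add: gamma_prod_source finite_prod_source source_power_Suc algebra_simps)
qed

theorem theorem1:
  fixes X :: "'x set" and Y :: "'y set"
  assumes "finite X" and "finite Y"
  shows "(\<forall>\<pi>\<^sub>1 \<pi>\<^sub>2 :: ('x \<times> 'y) pmf.
            set_pmf \<pi>\<^sub>1 \<subseteq> X \<times> Y \<longrightarrow> set_pmf \<pi>\<^sub>2 \<subseteq> X \<times> Y \<longrightarrow>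
            Gamma_src (source_prod \<pi>\<^sub>1 \<pi>\<^sub>2) = Gamma_src \<pi>\<^sub>1 + Gamma_src \<pi>\<^sub>2) \<and>
         (\<forall>(\<pi> :: ('x \<times> 'y) pmf) n :: nat.
            set_pmf \<pi> \<subseteq> X \<times> Y \<longrightarrow> n > 0 \<longrightarrow>
            Gamma_src (source_power n \<pi>) = ereal (real n) * Gamma_src \<pi>)"
proof -
  have fin: "finite (set_pmf \<pi>)" if "set_pmf \<pi> \<subseteq> X \<times> Y" for \<pi> :: "('x \<times> 'y) pmf"
    using that assms by (meson finite_SigmaI finite_subset)
  have "source_prod \<pi>\<^sub>1 \<pi>\<^sub>2 = prod_source \<pi>\<^sub>1 \<pi>\<^sub>2" for \<pi>\<^sub>1 \<pi>\<^sub>2 :: "('x \<times> 'y) pmf"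
    by (simp add: source_prod_def prod_source_def)
  \<comment> \<open>All supports are finite, so \<open>Gamma_src_eq\<close> turns both claims into
    real identities for \<open>gamma\<close>.\<close>
  then show ?thesis
    by (simp add: fin Gamma_src_eq finite_prod_source gamma_prod_source gamma_source_power)
qed

end
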